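(* There is no $1$-dimensional semialgebraic set $S\subset\mathbb{R}^m$ with $\mathrm{p}(S)=2$ and $\mathrm{r}(S)=1$.
   Context: A map $f=(f_1,\dots,f_m):\mathbb{R}^n\to\mathbb{R}^m$ is polynomial if each $f_i\in\mathbb{R}[x_1,\dots,x_n]$, and it is regular if each $f_i=g_i/h_i$ is a quotient of polynomials $g_i,h_i\in\mathbb{R}[x_1,\dots,x_n]$ such that the zero set of $h_i$ in $\mathbb{R}^n$ is empty. A set $S\subset\mathbb{R}^m$ is a polynomial (respectively regular) image of $\mathbb{R}^n$ if $S=f(\mathbb{R}^n)$ for some polynomial (respectively regular) map $f:\mathbb{R}^n\to\mathbb{R}^m$. The invariant $\mathrm{p}(S)$ (respectively $\mathrm{r}(S)$) is the least $k\geq1$ such that $S$ is a polynomial (respectively regular) image of $\mathbb{R}^k$, and $+\infty$ if there is no such $k$. *)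

theory Defs
  imports
    "HOL-Analysis.Analysis"
    "HOL-Algebra.Algebraic_Closure_Type"
    "HOL-Algebra.QuotRing"
    "HOL-Library.Extended_Nat"
    "HOL-Library.Poly_Mapping"
begin

text \<open>
  Formal real polynomials in variables indexed by \<open>'i\<close>: finitely supported maps from monomials
  (finitely supported exponent functions) to coefficients. The library's convolution product makes
  this type a commutative ring.
\<close>

type_synonym 'i rpoly = "('i \<Rightarrow>\<^sub>0 nat) \<Rightarrow>\<^sub>0 real"

definition rpoly_eval :: "'i rpoly \<Rightarrow> ('i \<Rightarrow> real) \<Rightarrow> real" where
  "rpoly_eval p x =
     (\<Sum>\<alpha>\<in>Poly_Mapping.keys p. Poly_Mapping.lookup p \<alpha> *
        (\<Prod>i\<in>Poly_Mapping.keys \<alpha>. x i ^ Poly_Mapping.lookup \<alpha> i))"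

text \<open>
  The domain \<open>\<real>\<^sup>k\<close> must allow a varying \<open>k\<close>, so it is the carrier of the library's
  \<open>Euclidean_space k\<close>: sequences \<open>x :: nat \<Rightarrow> real\<close> with \<open>x i = 0\<close> for \<open>i \<ge> k\<close>. Its coordinates, and
  the variables of polynomials on it, are numbered from \<open>0\<close> to \<open>k - 1\<close>.
\<close>

definition rpolys_in :: "nat \<Rightarrow> nat rpoly set" where
  "rpolys_in k = {p. \<forall>\<alpha>\<in>Poly_Mapping.keys p. Poly_Mapping.keys \<alpha> \<subseteq> {..<k}}"

definition polynomial_map :: "nat \<Rightarrow> ((nat \<Rightarrow> real) \<Rightarrow> real ^ 'm) \<Rightarrow> bool" where
  "polynomial_map k f \<longleftrightarrow>
     (\<forall>i. \<exists>p\<in>rpolys_in k. \<forall>x\<in>topspace (Euclidean_space k). f x $ i = rpoly_eval p x)"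

definition regular_map :: "nat \<Rightarrow> ((nat \<Rightarrow> real) \<Rightarrow> real ^ 'm) \<Rightarrow> bool" where
  "regular_map k f \<longleftrightarrow>
     (\<forall>i. \<exists>g\<in>rpolys_in k. \<exists>h\<in>rpolys_in k.
        {x \<in> topspace (Euclidean_space k). rpoly_eval h x = 0} = {} \<and>
        (\<forall>x\<in>topspace (Euclidean_space k). f x $ i = rpoly_eval g x / rpoly_eval h x))"

definition polynomial_image :: "nat \<Rightarrow> (real ^ 'm) set \<Rightarrow> bool" where
  "polynomial_image k S \<longleftrightarrow> (\<exists>f. polynomial_map k f \<and> S = f ` topspace (Euclidean_space k))"

definition regular_image :: "nat \<Rightarrow> (real ^ 'm) set \<Rightarrow> bool" where
  "regular_image k S \<longleftrightarrow> (\<exists>f. regular_map k f \<and> S = f ` topspace (Euclidean_space k))"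

text \<open>In \<open>enat\<close> the infimum of the empty set is \<open>\<infinity>\<close>.\<close>

definition p_invariant :: "(real ^ 'm) set \<Rightarrow> enat" where
  "p_invariant S = Inf {enat k |k. k \<ge> 1 \<and> polynomial_image k S}"

definition r_invariant :: "(real ^ 'm) set \<Rightarrow> enat" where
  "r_invariant S = Inf {enat k |k. k \<ge> 1 \<and> regular_image k S}"

inductive semialgebraic :: "(real ^ 'm) set \<Rightarrow> bool" where
  eq: "semialgebraic {x. rpoly_eval p (vec_nth x) = 0}"
| pos: "semialgebraic {x. rpoly_eval p (vec_nth x) > 0}"
| Un: "semialgebraic A \<Longrightarrow> semialgebraic B \<Longrightarrow> semialgebraic (A \<union> B)"
| Int: "semialgebraic A \<Longrightarrow> semialgebraic B \<Longrightarrow> semialgebraic (A \<inter> B)"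
| Compl: "semialgebraic A \<Longrightarrow> semialgebraic (- A)"

text \<open>
  The dimension of a semialgebraic set \<open>S\<close> is that of Bochnak, Coste and Roy (Real Algebraic
  Geometry, Section 2.8): the Krull dimension of the ring of polynomial functions on \<open>S\<close>, that is,
  of the polynomial ring modulo the ideal of polynomials vanishing on \<open>S\<close>. The supremum is taken in
  \<open>ereal\<close> so that the zero ring (the case \<open>S = {}\<close>) gets dimension \<open>-\<infinity>\<close>.
\<close>

definition krull_dim :: "('a, 'b) ring_scheme \<Rightarrow> ereal" where
  "krull_dim R = Sup {ereal (real d) |d.
     \<exists>P :: nat \<Rightarrow> 'a set. (\<forall>i\<le>d. primeideal (P i) R) \<and> (\<forall>i<d. P i \<subset> P (Suc i))}"

definition vanishing_ideal :: "(real ^ 'm) set \<Rightarrow> 'm rpoly set" where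
  "vanishing_ideal S = {p. \<forall>x\<in>S. rpoly_eval p (vec_nth x) = 0}"

definition semialgebraic_dim :: "(real ^ 'm) set \<Rightarrow> ereal" where
  "semialgebraic_dim S = krull_dim ((ring_of_type_algebra :: 'm rpoly ring) Quot vanishing_ideal S)"

end

theory Submission
  imports Defs
begin

text \<open>
  Write \<open>S = g(\<real>)\<close> with \<open>g\<close> regular. A polynomial map from the plane onto \<open>S\<close>, restricted to a suitable
  line, gives a nonconstant polynomial curve \<open>q\<close> in \<open>S\<close> (unless \<open>S\<close> is a point).
  For almost all \<open>s\<close> the elementary symmetric functions of the complex fibre \<open>{z. q z = q s}\<close> are
  polynomials in \<open>s\<close>, and any nonconstant one, \<open>\<theta>\<close>, satisfies \<open>q = Q \<circ> \<theta>\<close> with \<open>Q\<close> polynomial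
  (a form of Lueroth's theorem). The same symmetric function of \<open>{z. q z = g t}\<close> is rational in \<open>t\<close>; in
  lowest terms \<open>\<psi> = \<nu> / \<rho>\<close> it satisfies \<open>g = Q \<circ> \<psi>\<close>, and it has no real pole because \<open>Q \<circ> \<psi>\<close> has none.
  Since \<open>g\<close> is unbounded, \<open>\<psi>\<close> is proper, so \<open>\<psi>(\<real>)\<close> is \<open>\<real>\<close> or a closed half-line and hence the image of a
  polynomial \<open>p\<close>. Thus \<open>S = Q(p(\<real>))\<close> is a polynomial image of \<open>\<real>\<close>.
\<close>

hide_const (open) Module.smult up_ring.coeff up_ring.monom Polynomials.degree Polynomials.lead_coeff Coset.order

section \<open>Complex values of real polynomials\<close>

text \<open>Serves two maps \<open>h\<close>: the embedding of the reals into the complex numbers,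
  and \<open>\<lambda>c. ceval c t\<close>, which evaluates coefficients that are themselves
  polynomials.\<close>

lemma map_poly_hom_mult:
  fixes h :: "'a::comm_ring_1 \<Rightarrow> 'b::comm_ring_1"
  assumes "h 0 = 0" "\<And>a b. h (a + b) = h a + h b" "\<And>a b. h (a * b) = h a * h b"
  shows "map_poly h (p * q) = map_poly h p * map_poly h q"
proof -
  have sum: "h (sum f A) = (\<Sum>x\<in>A. h (f x))" for f :: "nat \<Rightarrow> 'a" and A
    by (induction A rule: infinite_finite_induct) (simp_all add: assms)
  show ?thesis
    by (rule poly_eqI) (simp add: coeff_map_poly assms coeff_mult sum)
qed

lemma map_poly_hom_add:
  assumes "h 0 = 0" "\<And>a b. h (a + b) = h a + h b"
  shows "map_poly h (p + q) = map_poly h p + map_poly h q"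
  by (rule poly_eqI) (simp add: coeff_map_poly assms)

definition ceval :: "real poly \<Rightarrow> complex \<Rightarrow> complex" where
  "ceval p z = poly (map_poly of_real p) z"

lemma ceval_simps [simp]:
  "ceval 0 z = 0"
  "ceval 1 z = 1"
  "ceval (p + q) z = ceval p z + ceval q z"
  "ceval (p * q) z = ceval p z * ceval q z"
  "ceval [:a:] z = of_real a"
  by (simp_all add: ceval_def map_poly_hom_mult map_poly_hom_add map_poly_pCons map_poly_1)

lemma ceval_smult [simp]: "ceval (smult a p) z = of_real a * ceval p z"
  using ceval_simps(4)[of "[:a:]" p z] by simp

lemma ceval_uminus [simp]: "ceval (- p) z = - ceval p z"
  using ceval_smult[of "-1" p z] by simp

lemma ceval_diff [simp]: "ceval (p - q) z = ceval p z - ceval q z"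
  using ceval_simps(3)[of p "- q" z] by simp

lemma ceval_pCons [simp]: "ceval (pCons a p) z = of_real a + z * ceval p z"
  by (simp add: ceval_def map_poly_pCons)

lemma ceval_of_real [simp]: "ceval p (of_real x) = of_real (poly p x)"
  by (induction p) simp_all

lemma map_poly_of_real_eq_0 [simp]: "map_poly complex_of_real p = 0 \<longleftrightarrow> p = 0"
  by (simp add: map_poly_eq_0_iff)

lemma finite_ceval_roots: "p \<noteq> 0 \<Longrightarrow> finite {z. ceval p z = 0}"
  unfolding ceval_def by (rule poly_roots_finite) simp

lemma continuous_ceval [continuous_intros]:
  "continuous_on A f \<Longrightarrow> continuous_on A (\<lambda>x. ceval p (f x))"
  unfolding ceval_def by (intro continuous_intros)

lemma degree_map_poly_of_real [simp]: "degree (map_poly complex_of_real p) = degree p"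
  by (rule degree_map_poly) simp

section \<open>Fibres of a polynomial curve\<close>

text \<open>The element \<open>M\<close> plays the role of a greatest common divisor of the \<open>B i\<close> over the field of fractions.\<close>

lemma ideal_min_degree_element:
  fixes B :: "'i::finite \<Rightarrow> 'a::idom poly"
  assumes "B k \<noteq> 0"
  shows "\<exists>M A a U. M \<noteq> 0 \<and> M = (\<Sum>i\<in>UNIV. A i * B i) \<and>
    (\<forall>i. a i \<noteq> 0 \<and> smult (a i) (B i) = M * U i)"
proof -
  define I where "I = {M. \<exists>A. M = (\<Sum>i\<in>UNIV. A i * B i)}"
  have mem: "B i \<in> I" for i
    unfolding I_def
    by (intro CollectI exI[of _ "\<lambda>j. if j = i then 1 else 0"]) (simp add: if_distrib[of "\<lambda>x. x * _"] cong: if_cong)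
  have sub: "x - y \<in> I" if xy: "x \<in> I" "y \<in> I" for x y
  proof -
    obtain A A' where "x = (\<Sum>i\<in>UNIV. A i * B i)" "y = (\<Sum>i\<in>UNIV. A' i * B i)"
      using xy by (auto simp: I_def)
    then have "x - y = (\<Sum>i\<in>UNIV. (A i - A' i) * B i)"
      by (simp add: sum_subtractf left_diff_distrib)
    then show ?thesis unfolding I_def by (intro CollectI exI)
  qed
  have mul: "c * x \<in> I" if x: "x \<in> I" for c x
  proof -
    obtain A where "x = (\<Sum>i\<in>UNIV. A i * B i)"
      using x by (auto simp: I_def)
    then have "c * x = (\<Sum>i\<in>UNIV. (c * A i) * B i)"
      by (simp add: sum_distrib_left mult.assoc)
    then show ?thesis unfolding I_def by (intro CollectI exI)
  qed
  \<comment> \<open>The coefficients form only a domain, so an element of least degree replaces the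
    generator that Euclid's algorithm would give over a field.\<close>
  obtain M where M: "M \<in> I" "M \<noteq> 0" and min: "\<And>x. x \<in> I \<Longrightarrow> x \<noteq> 0 \<Longrightarrow> degree M \<le> degree x"
    using ex_has_least_nat[of "\<lambda>x. x \<in> I \<and> x \<noteq> 0" "B k" degree] mem assms by auto
  have "\<exists>a U. a \<noteq> 0 \<and> smult a (B i) = M * U" for i
  proof -
    \<comment> \<open>Pseudo-division: the multiplier \<open>a\<close> makes up for the missing
      inverse of the leading coefficient. The remainder lies in \<open>I\<close> and, unless it is
      zero, has smaller degree than \<open>M\<close>, so minimality kills it.\<close>
    obtain a U where a: "a \<noteq> 0" "smult a (B i) = M * U + pseudo_mod (B i) M"
      using pseudo_mod(1)[OF M(2)] by blast
    have "pseudo_mod (B i) M = [:a:] * B i - U * M"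
      using a(2) by (simp add: algebra_simps)
    then have "pseudo_mod (B i) M \<in> I"
      by (metis sub mul mem M(1))
    then have "pseudo_mod (B i) M = 0"
      using pseudo_mod(2)[OF M(2), of "B i"] min by force
    then show ?thesis using a by auto
  qed
  then have "\<exists>a U. \<forall>i. a i \<noteq> 0 \<and> smult (a i) (B i) = M * U i" by metis
  then show ?thesis using M unfolding I_def by blast
qed

section \<open>Fibre polynomials and specialization of the parameter\<close>

definition fibre :: "('m \<Rightarrow> real poly) \<Rightarrow> ('m \<Rightarrow> complex) \<Rightarrow> complex set" where
  "fibre q w = {z. \<forall>i. ceval (q i) z = w i}"

text \<open>Up to sign, its coefficients are the elementary symmetric functions of the fibre. For an
  infinite fibre the product takes the default value 1.\<close>

definition fibre_poly :: "('m \<Rightarrow> real poly) \<Rightarrow> ('m \<Rightarrow> complex) \<Rightarrow> complex poly" where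
  "fibre_poly q w = (\<Prod>z\<in>fibre q w. [:- z, 1:])"

text \<open>The inner variable is the parameter, which becomes the complex number \<open>t\<close>;
  the outer variable, which runs over the fibre, remains.\<close>

definition specialize :: "complex \<Rightarrow> real poly poly \<Rightarrow> complex poly" where
  "specialize t = map_poly (\<lambda>c. ceval c t)"

lemma specialize_mult [simp]: "specialize t (p * q) = specialize t p * specialize t q"
  unfolding specialize_def by (rule map_poly_hom_mult) simp_all

lemma specialize_add [simp]: "specialize t (p + q) = specialize t p + specialize t q"
  unfolding specialize_def by (rule map_poly_hom_add) simp_all

lemma specialize_0 [simp]: "specialize t 0 = 0"
  by (simp add: specialize_def)

lemma coeff_specialize [simp]: "coeff (specialize t p) n = ceval (coeff p n) t"
  by (simp add: specialize_def coeff_map_poly)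

lemma specialize_diff [simp]: "specialize t (p - q) = specialize t p - specialize t q"
  by (rule poly_eqI) simp

lemma specialize_smult [simp]: "specialize t (smult c p) = smult (ceval c t) (specialize t p)"
  by (rule poly_eqI) simp

lemma specialize_sum [simp]: "specialize t (sum f A) = (\<Sum>x\<in>A. specialize t (f x))"
  by (induction A rule: infinite_finite_induct) simp_all

lemma specialize_const [simp]: "specialize t [:c:] = [:ceval c t:]"
  by (simp add: specialize_def map_poly_pCons)

lemma specialize_lift [simp]:
  "specialize t (map_poly (\<lambda>c. [:c:]) p) = map_poly of_real p"
  by (rule poly_eqI) (simp add: coeff_map_poly)

lemma ceval_pderiv: "ceval (pderiv p) z = poly (pderiv (map_poly of_real p)) z"
proof -
  have "map_poly complex_of_real (pderiv p) = pderiv (map_poly of_real p)"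
    by (rule poly_eqI) (simp add: coeff_map_poly coeff_pderiv)
  then show ?thesis by (simp add: ceval_def)
qed

lemma finite_ceval_eq: "degree p \<noteq> 0 \<Longrightarrow> finite {z. ceval p z = c}"
proof -
  assume "degree p \<noteq> 0"
  then have "map_poly of_real p - [:c:] \<noteq> 0"
    by (metis degree_map_poly_of_real degree_pCons_0 eq_iff_diff_eq_0)
  then have "finite {z. poly (map_poly of_real p - [:c:]) z = 0}"
    by (rule poly_roots_finite)
  then show ?thesis by (simp add: ceval_def)
qed

lemma finite_ceval_vimage: "degree p \<noteq> 0 \<Longrightarrow> finite A \<Longrightarrow> finite {z. ceval p z \<in> A}"
proof -
  assume "degree p \<noteq> 0" "finite A"
  then have "finite (\<Union>a\<in>A. {z. ceval p z = a})"
    by (simp add: finite_ceval_eq)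
  then show ?thesis by (rule rev_finite_subset) auto
qed

lemma finite_fibre: "degree (q k) \<noteq> 0 \<Longrightarrow> finite (fibre q w)"
  by (rule finite_subset[OF _ finite_ceval_eq[of "q k" "w k"]]) (auto simp: fibre_def)

lemma poly_fibre_poly_eq_0_iff:
  "finite (fibre q w) \<Longrightarrow> poly (fibre_poly q w) z = 0 \<longleftrightarrow> z \<in> fibre q w"
  by (auto simp: fibre_poly_def poly_prod)

lemma degree_fibre_poly: "degree (fibre_poly q w) = card (fibre q w)"
  unfolding fibre_poly_def by (subst degree_prod_sum_eq) auto

text \<open>
  The assumption on \<open>pderiv (q k)\<close> keeps the common divisor of the specialized polynomials squarefree, so
  that it is a scalar multiple of \<open>fibre_poly q w\<close>.
\<close>

lemma fibre_poly_rational: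
  fixes q u h :: "'m::finite \<Rightarrow> real poly"
  assumes k: "degree (q k) \<noteq> 0" and h: "\<And>i. h i \<noteq> 0"
  obtains e r n T where "finite T"
    "\<And>t w. t \<notin> T \<Longrightarrow> (\<And>i. ceval (h i) t * w i = ceval (u i) t) \<Longrightarrow>
       (\<And>z. ceval (q k) z = w k \<Longrightarrow> ceval (pderiv (q k)) z \<noteq> 0) \<Longrightarrow>
       ceval r t \<noteq> 0 \<and> card (fibre q w) = e \<and> (\<forall>j. ceval (n j) t = ceval r t * coeff (fibre_poly q w) j)"
proof -
  \<comment> \<open>At a parameter \<open>t\<close> with \<open>h_i(t) w_i = u_i(t)\<close> this
    specializes to \<open>h_i(t)\<close> times \<open>q_i - w_i\<close>, so off the zeros of the
    \<open>h i\<close> the common roots are exactly the fibre over \<open>w\<close>.\<close>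
  define B where "B i = smult (h i) (map_poly (\<lambda>c. [:c:]) (q i)) - [:u i:]" for i
  have "coeff (B k) (degree (q k)) = h k * [:lead_coeff (q k):]"
    using k by (cases "degree (q k)") (auto simp: B_def coeff_map_poly)
  then have "B k \<noteq> 0"
    using h[of k] k by (metis coeff_0 degree_0 leading_coeff_0_iff mult_eq_0_iff pCons_eq_0_iff)
  then obtain M A a U where MU: "M \<noteq> 0 \<and> M = (\<Sum>i\<in>UNIV. A i * B i) \<and>
      (\<forall>i. a i \<noteq> 0 \<and> smult (a i) (B i) = M * U i)"
    using ideal_min_degree_element[of B k] by blast
  have M: "M \<noteq> 0" "M = (\<Sum>i\<in>UNIV. A i * B i)" and a: "a i \<noteq> 0"
    and U: "smult (a i) (B i) = M * U i" for i
    using MU by blast+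
  define r where "r = lead_coeff M"
  \<comment> \<open>Excluded are the parameters where the degree of \<open>M\<close> drops, where a
    multiplier \<open>a i\<close> vanishes, or where a denominator \<open>h i\<close>
    vanishes.\<close>
  define T where "T = {t. ceval r t = 0} \<union> (\<Union>i. {t. ceval (a i) t = 0}) \<union> (\<Union>i. {t. ceval (h i) t = 0})"
  have "finite T"
    unfolding T_def using M(1) a h by (auto intro!: finite_ceval_roots simp: r_def)
  moreover have "ceval r t \<noteq> 0 \<and> card (fibre q w) = degree M \<and>
      (\<forall>j. ceval (coeff M j) t = ceval r t * coeff (fibre_poly q w) j)"
    if t: "t \<notin> T" and w: "\<And>i. ceval (h i) t * w i = ceval (u i) t"
      and reg: "\<And>z. ceval (q k) z = w k \<Longrightarrow> ceval (pderiv (q k)) z \<noteq> 0" for t w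
  proof -
    have nz: "ceval r t \<noteq> 0" "ceval (a i) t \<noteq> 0" "ceval (h i) t \<noteq> 0" for i
      using t by (auto simp: T_def)
    define W where "W i = map_poly of_real (q i) - [:w i:]" for i
    have W: "poly (W i) z = ceval (q i) z - w i" for i z
      by (simp add: W_def ceval_def)
    have B: "specialize t (B i) = smult (ceval (h i) t) (W i)" for i
      by (simp add: B_def W_def smult_diff_right w)
    define N where "N = specialize t M"
    have N: "N = (\<Sum>i\<in>UNIV. specialize t (A i) * smult (ceval (h i) t) (W i))"
      unfolding N_def by (subst M(2)) (simp add: B)
    define c where "c i = ceval (a i) t * ceval (h i) t" for i
    have c: "c i \<noteq> 0" for i using nz by (simp add: c_def)
    have NU: "smult (c i) (W i) = N * specialize t (U i)" for i
      using arg_cong[OF U, of "specialize t" i] by (simp add: B N_def c_def)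
    have deg: "degree N = degree M" "lead_coeff N = ceval r t"
    proof -
      have "coeff N (degree M) \<noteq> 0" using nz by (simp add: N_def r_def)
      moreover have "degree N \<le> degree M"
        by (rule degree_le) (simp add: N_def coeff_eq_0)
      ultimately show "degree N = degree M" by (simp add: le_antisym le_degree)
      then show "lead_coeff N = ceval r t" by (simp add: N_def r_def)
    qed
    \<comment> \<open>\<open>N\<close> divides a nonzero multiple of every \<open>W i\<close>, and
      it is also a combination of the \<open>W i\<close>; these give the two inclusions.\<close>
    have roots: "{z. poly N z = 0} = fibre q w"
    proof (intro equalityI subsetI)
      fix z assume "z \<in> {z. poly N z = 0}"
      then have "poly (smult (c i) (W i)) z = 0" for i
        by (simp add: NU)
      then show "z \<in> fibre q w"
        using c by (simp add: fibre_def W)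
    next
      fix z assume "z \<in> fibre q w"
      then show "z \<in> {z. poly N z = 0}"
        by (simp add: N poly_sum W fibre_def)
    qed
    have "rsquarefree N"
      unfolding rsquarefree_roots
    proof (intro allI notI, elim conjE)
      fix z assume z: "poly N z = 0" "poly (pderiv N) z = 0"
      have "poly (pderiv (smult (c k) (W k))) z = 0"
        unfolding NU using z by (simp add: pderiv_mult)
      then have "ceval (pderiv (q k)) z = 0"
        using c by (simp add: pderiv_smult W_def pderiv_diff pderiv_pCons ceval_pderiv)
      moreover have "ceval (q k) z = w k"
        using z(1) roots by (auto simp: fibre_def)
      ultimately show False using reg by blast
    qed
    then have eq: "N = smult (ceval r t) (fibre_poly q w)"
      using complex_poly_decompose_rsquarefree[of N] by (simp only: roots deg(2) fibre_poly_def)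
    then have "degree M = card (fibre q w)"
      using nz deg(1) by (simp add: degree_fibre_poly)
    moreover have "ceval (coeff M j) t = ceval r t * coeff (fibre_poly q w) j" for j
      using arg_cong[OF eq, of "\<lambda>p. coeff p j"] by (simp add: N_def)
    ultimately show ?thesis using nz by simp
  qed
  ultimately show thesis using that[of T r "degree M" "coeff M"] by blast
qed

section \<open>Growth of polynomials\<close>

lemma reduced_fraction:
  fixes m r :: "real poly"
  assumes "r \<noteq> 0"
  obtains g m' r' where "m = g * m'" "r = g * r'" "coprime m' r'" "g \<noteq> 0" "r' \<noteq> 0"
proof -
  obtain m' r' where "m = m' * gcd m r" "r = r' * gcd m r" "coprime m' r'"
    using gcd_coprime_exists[of m r] assms by auto
  then show thesis using that[of "gcd m r" m' r'] assms by (metis mult.commute mult_zero_right)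
qed

text \<open>A Bezout identity between real polynomials survives evaluation at a complex
  point.\<close>

lemma coprime_no_common_ceval_root:
  assumes "coprime m (r :: real poly)" "ceval r z = 0"
  shows "ceval m z \<noteq> 0"
proof
  assume "ceval m z = 0"
  obtain a b where "a * m + b * r = 1"
    using bezout_coefficients_fst_snd[of m r] assms(1) by (metis coprime_iff_gcd_eq_1)
  from arg_cong[OF this, of "\<lambda>p. ceval p z"] show False
    using assms(2) \<open>ceval m z = 0\<close> by simp
qed

text \<open>The inequality holds on a closed set, and the complement of a finite set is
  dense.\<close>

lemma le_off_finite_imp_le:
  fixes f g :: "'a::{euclidean_space} \<Rightarrow> real"
  assumes "continuous_on UNIV f" "continuous_on UNIV g" "finite T" "\<And>z. z \<notin> T \<Longrightarrow> f z \<le> g z"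
  shows "f z \<le> g z"
proof -
  have "closed {z. f z \<le> g z}"
    using assms(1,2) by (intro closed_Collect_le)
  moreover have "- T \<subseteq> {z. f z \<le> g z}" using assms(4) by auto
  ultimately have "closure (- T) \<subseteq> {z. f z \<le> g z}" by (simp add: closure_minimal)
  moreover have "closure (- T) = UNIV"
    using assms(3) by (simp add: closure_complement empty_interior_finite)
  ultimately show ?thesis by auto
qed

lemma ceval_root_exists: "degree p \<noteq> 0 \<Longrightarrow> \<exists>z. ceval p z = 0"
  unfolding ceval_def by (rule fundamental_theorem_of_algebra) (simp add: constant_degree)

text \<open>Otherwise \<open>(1 + x) ^ e / poly p x\<close> would tend to 0 and finally drop below
  \<open>1 / (\<bar>K\<bar> + 1)\<close>, against the bound. The added 1 keeps this threshold
  meaningful when \<open>K\<close> is 0.\<close>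

lemma degree_le_if_growth_le:
  fixes p :: "real poly"
  assumes bound: "\<And>x. x \<ge> 0 \<Longrightarrow> \<bar>poly p x\<bar> \<le> K * (1 + x) ^ e"
  shows "degree p \<le> e"
proof (rule ccontr)
  assume "\<not> degree p \<le> e"
  then have deg: "degree ([:1, 1 :: real:] ^ e) < degree p"
    by (simp add: degree_power_eq)
  have "((\<lambda>x. poly ([:1, 1 :: real:] ^ e) x / poly p x) \<longlongrightarrow> 0) at_infinity"
    by (rule poly_divide_tendsto_0_at_infinity[OF deg])
  then have lim: "((\<lambda>x. (1 + x) ^ e / poly p x) \<longlongrightarrow> 0) at_top"
    using tendsto_mono[OF at_top_le_at_infinity] by simp
  have "eventually (\<lambda>x. \<bar>(1 + x) ^ e / poly p x\<bar> < 1 / (\<bar>K\<bar> + 1)) at_top"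
    using order_tendstoD(2)[OF tendsto_rabs[OF lim], of "1 / (\<bar>K\<bar> + 1)"] by simp
  moreover have "eventually (\<lambda>x. poly p x \<noteq> 0) at_top"
    using deg by (intro filterlim_at_infinity_imp_eventually_ne
        filterlim_mono[OF filterlim_poly_at_infinity order_refl at_top_le_at_infinity]) simp
  ultimately have "eventually (\<lambda>x. False) (at_top :: real filter)"
    using eventually_ge_at_top[of "0::real"]
  proof eventually_elim
    case (elim x)
    have "(1 + x) ^ e > 0" using elim(3) by simp
    then have "(1 + x) ^ e * (\<bar>K\<bar> + 1) < \<bar>poly p x\<bar>"
      using elim(1,2) by (simp add: field_simps abs_divide)
    also have "\<dots> \<le> K * (1 + x) ^ e" using bound elim(3) by simp
    also have "\<dots> \<le> (1 + x) ^ e * (\<bar>K\<bar> + 1)"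
      using \<open>(1 + x) ^ e > 0\<close> by (simp add: mult.commute[of K])
    finally show False by simp
  qed
  then show False by simp
qed

text \<open>In lowest terms, the bound makes every complex zero of the denominator a zero of the
  numerator. Hence the denominator is constant, and the growth along the positive reals limits the
  degree of the quotient.\<close>

lemma quotient_polynomial_if_growth_le:
  assumes r: "r \<noteq> 0" and T: "finite T"
    and bound: "\<And>z. z \<notin> T \<Longrightarrow> norm (ceval m z) \<le> C * norm (ceval r z) * (1 + norm z) ^ e"
  obtains c where "m = r * c" "degree c \<le> e"
proof -
  obtain g m' r' where red: "m = g * m'" "r = g * r'" "coprime m' r'" "g \<noteq> 0" "r' \<noteq> 0"
    using reduced_fraction[OF r] by metis
  \<comment> \<open>The common factor \<open>g\<close> cancels off its zeros; continuity restores
    the bound at these and on \<open>T\<close>.\<close>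
  have bound': "norm (ceval m' z) \<le> C * norm (ceval r' z) * (1 + norm z) ^ e" for z
  proof (rule le_off_finite_imp_le[where T = "T \<union> {z. ceval g z = 0}"])
    fix z assume "z \<notin> T \<union> {z. ceval g z = 0}"
    then show "norm (ceval m' z) \<le> C * norm (ceval r' z) * (1 + norm z) ^ e"
      using bound[of z] by (simp add: red norm_mult mult.left_commute mult.assoc)
  qed (auto intro!: continuous_intros simp: T red finite_ceval_roots)
  have "degree r' = 0"
  proof (rule ccontr)
    assume "degree r' \<noteq> 0"
    then obtain z where "ceval r' z = 0" using ceval_root_exists by blast
    then show False
      using bound'[of z] coprime_no_common_ceval_root[OF red(3), of z] by simp
  qed
  then obtain d where d: "r' = [:d:]" "d \<noteq> 0"
    using red(5) degree_eq_zeroE by (metis pCons_0_0)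
  have "\<bar>poly m' x\<bar> \<le> (C * \<bar>d\<bar>) * (1 + x) ^ e" if "x \<ge> 0" for x
    using bound'[of "of_real x"] that by (simp add: d)
  then have "degree m' \<le> e" by (rule degree_le_if_growth_le)
  then show thesis
    using that[of "smult (1 / d) m'"] d red by simp
qed

text \<open>For large \<open>z\<close> the leading term dominates, so \<open>ceval p z\<close> has
  size at least of order \<open>norm z ^ d\<close>, while \<open>ceval p s\<close> has size at most
  of order \<open>(1 + norm s) ^ d\<close>.\<close>

lemma ceval_eq_imp_norm_le:
  assumes "degree p \<noteq> 0"
  obtains C where "C \<ge> 1" "\<And>z s. ceval p z = ceval p s \<Longrightarrow> norm z \<le> C * (1 + norm s)"
proof -
  define d where "d = degree p"
  define a where "a = \<bar>lead_coeff p\<bar>"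
  define A where "A = (\<Sum>i\<le>d. \<bar>coeff p i\<bar>)"
  \<comment> \<open>Beyond \<open>2 * A / a\<close> the lower terms amount to at most half of the
    leading term; the 1 ensures \<open>norm z > 1\<close>, where powers of \<open>norm z\<close>
    increase with the exponent.\<close>
  define C where "C = max 1 (2 * A / a)"
  have a: "a > 0" using assms by (auto simp: a_def)
  have A: "A \<ge> 0" by (simp add: A_def sum_nonneg)
  have C: "C \<ge> 1" "2 * A \<le> a * C"
    using a by (auto simp: C_def field_simps max_def)
  have expand: "ceval p z = (\<Sum>i\<le>d. of_real (coeff p i) * z ^ i)" for z
    by (simp add: ceval_def poly_altdef d_def coeff_map_poly)
  have "norm z \<le> C * (1 + norm s)" if eq: "ceval p z = ceval p s" for z s
  proof (rule ccontr)
    assume "\<not> ?thesis"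
    then have z: "norm z > C * (1 + norm s)" by simp
    have "C * 1 \<le> C * (1 + norm s)" using C(1) by (intro mult_left_mono) auto
    then have z1: "norm z > C" "norm z > 1" using z C(1) by linarith+
    have "norm (ceval p s) \<le> (\<Sum>i\<le>d. norm (of_real (coeff p i) * s ^ i))"
      unfolding expand by (rule norm_sum)
    also have "\<dots> \<le> (\<Sum>i\<le>d. \<bar>coeff p i\<bar> * (1 + norm s) ^ d)"
    proof (intro sum_mono)
      fix i assume "i \<in> {..d}"
      have "norm s ^ i \<le> (1 + norm s) ^ i" by (intro power_mono) auto
      also have "\<dots> \<le> (1 + norm s) ^ d" using \<open>i \<in> {..d}\<close> by (intro power_increasing) auto
      finally show "norm (of_real (coeff p i) * s ^ i) \<le> \<bar>coeff p i\<bar> * (1 + norm s) ^ d"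
        by (simp add: norm_mult norm_power mult_left_mono)
    qed
    also have "\<dots> = A * (1 + norm s) ^ d" by (simp add: A_def sum_distrib_right)
    finally have up: "norm (ceval p s) \<le> A * (1 + norm s) ^ d" .
    obtain d' where d': "d = Suc d'" using assms by (auto simp: d_def gr0_conv_Suc)
    have "ceval p z = of_real (lead_coeff p) * z ^ d + (\<Sum>i\<le>d'. of_real (coeff p i) * z ^ i)"
      unfolding expand by (simp add: d' d_def[symmetric])
    then have "norm (ceval p z) \<ge> a * norm z ^ d - norm (\<Sum>i\<le>d'. of_real (coeff p i) * z ^ i)"
      using norm_diff_ineq[of "of_real (lead_coeff p) * z ^ d" "\<Sum>i\<le>d'. of_real (coeff p i) * z ^ i"]
      by (simp add: norm_mult norm_power a_def)
    moreover have "norm (\<Sum>i\<le>d'. of_real (coeff p i) * z ^ i) \<le> A * norm z ^ d'"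
    proof -
      have "norm (\<Sum>i\<le>d'. of_real (coeff p i) * z ^ i) \<le> (\<Sum>i\<le>d'. \<bar>coeff p i\<bar> * norm z ^ d')"
      proof (rule sum_norm_le)
        fix i assume "i \<in> {..d'}"
        then have "norm z ^ i \<le> norm z ^ d'" using z1 by (intro power_increasing) auto
        then show "norm (of_real (coeff p i) * z ^ i) \<le> \<bar>coeff p i\<bar> * norm z ^ d'"
          by (simp add: norm_mult norm_power mult_left_mono)
      qed
      also have "\<dots> = (\<Sum>i\<le>d'. \<bar>coeff p i\<bar>) * norm z ^ d'" by (simp add: sum_distrib_right)
      also have "\<dots> \<le> A * norm z ^ d'"
        by (intro mult_right_mono) (auto simp: A_def d')
      finally show ?thesis .
    qed
    moreover have "2 * A * norm z ^ d' \<le> a * norm z ^ d"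
    proof -
      have "2 * A \<le> a * norm z" using C(2) z1(1) a by (smt (verit) mult_left_mono)
      then have "2 * A * norm z ^ d' \<le> a * norm z * norm z ^ d'" by (intro mult_right_mono) auto
      then show ?thesis by (simp add: d' mult.assoc)
    qed
    ultimately have low: "2 * norm (ceval p z) \<ge> a * norm z ^ d" by simp
    have "C * (1 + norm s) ^ d \<le> (C * (1 + norm s)) ^ d"
    proof -
      have "C ^ 1 \<le> C ^ d" using C(1) d' by (intro power_increasing) auto
      then show ?thesis by (simp add: power_mult_distrib mult_right_mono)
    qed
    also have "\<dots> < norm z ^ d"
      using z C(1) d' by (intro power_strict_mono) auto
    finally have "a * (C * (1 + norm s) ^ d) < a * norm z ^ d" using a by simp
    moreover have "2 * A * (1 + norm s) ^ d \<le> a * C * (1 + norm s) ^ d"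
      using C(2) by (intro mult_right_mono) auto
    ultimately show False using low up eq by (simp add: mult.assoc)
  qed
  then show thesis using that C(1) by blast
qed

text \<open>Multiplication by \<open>[:- z, 1:]\<close> adds the preceding coefficient to
  \<open>- z\<close> times the current one, so each factor costs at most
  \<open>1 + R\<close>.\<close>

lemma norm_coeff_prod_linear_le:
  fixes F :: "complex set"
  assumes "finite F" "\<And>z. z \<in> F \<Longrightarrow> norm z \<le> R" "R \<ge> 0"
  shows "norm (coeff (\<Prod>z\<in>F. [:- z, 1:]) j) \<le> (1 + R) ^ card F"
  using assms(1,2)
proof (induction F arbitrary: j rule: finite_induct)
  case empty
  then show ?case by (simp add: coeff_1)
next
  case (insert z F)
  define P where "P = (\<Prod>z\<in>F. [:- z, 1:])"
  have IH: "norm (coeff P j) \<le> (1 + R) ^ card F" for j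
    using insert by (simp add: P_def)
  have "norm (coeff ([:- z, 1:] * P) j) \<le> norm z * norm (coeff P j) + (1 + R) ^ card F"
  proof (cases j)
    case 0
    then show ?thesis using assms(3) by (simp add: norm_mult)
  next
    case (Suc i)
    have "norm (coeff ([:- z, 1:] * P) j) = norm (- (z * coeff P j) + coeff P i)"
      by (simp add: Suc)
    also have "\<dots> \<le> norm (- (z * coeff P j)) + norm (coeff P i)"
      by (rule norm_triangle_ineq)
    finally show ?thesis using IH[of i] by (simp add: norm_mult)
  qed
  also have "\<dots> \<le> R * (1 + R) ^ card F + (1 + R) ^ card F"
    using IH[of j] insert.prems assms(3) by (intro add_right_mono mult_mono) auto
  finally show ?case using insert.hyps by (simp add: P_def algebra_simps)
qed

section \<open>A generator of the fibre invariants\<close>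

text \<open>For \<open>u = q\<close> and \<open>h = 1\<close> the coefficients of the fibre
  polynomial are rational in \<open>s\<close>. All points of the fibre have norm at most
  \<open>C * (1 + norm s)\<close>, so the coefficients grow at most like
  \<open>(1 + norm s) ^ e\<close>; this excludes poles and bounds the degree by the size of the
  fibre.\<close>

lemma fibre_poly_polynomial:
  fixes q :: "'m::finite \<Rightarrow> real poly"
  assumes k: "degree (q k) \<noteq> 0"
  obtains e c T where "finite T" "\<And>j. degree (c j) \<le> e"
    "\<And>s. s \<notin> T \<Longrightarrow> card (fibre q (\<lambda>i. ceval (q i) s)) = e \<and>
       (\<forall>j. coeff (fibre_poly q (\<lambda>i. ceval (q i) s)) j = ceval (c j) s)"
proof -
  obtain e r n T0 where T0: "finite T0"
    and gen: "\<And>t w. t \<notin> T0 \<Longrightarrow> (\<And>i. ceval 1 t * w i = ceval (q i) t) \<Longrightarrow>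
       (\<And>z. ceval (q k) z = w k \<Longrightarrow> ceval (pderiv (q k)) z \<noteq> 0) \<Longrightarrow>
       ceval r t \<noteq> 0 \<and> card (fibre q w) = e \<and> (\<forall>j. ceval (n j) t = ceval r t * coeff (fibre_poly q w) j)"
    using fibre_poly_rational[where q = q and u = q and h = "\<lambda>_. 1" and k = k] k by (smt (verit) zero_neq_one)
  \<comment> \<open>The critical values of \<open>q k\<close>. Parameters with a value in
    \<open>V\<close> are put into \<open>T\<close>, so that the fibres that remain meet the
    squarefreeness condition.\<close>
  define V where "V = ceval (q k) ` {z. ceval (pderiv (q k)) z = 0}"
  have "pderiv (q k) \<noteq> 0" using k by (simp add: pderiv_eq_0_iff)
  then have "finite V" by (simp add: V_def finite_ceval_roots)
  define T where "T = T0 \<union> {s. ceval (q k) s \<in> V}"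
  have T: "finite T" using T0 k \<open>finite V\<close> by (simp add: T_def finite_ceval_vimage)
  have *: "ceval r s \<noteq> 0 \<and> card (fibre q (\<lambda>i. ceval (q i) s)) = e \<and>
      (\<forall>j. ceval (n j) s = ceval r s * coeff (fibre_poly q (\<lambda>i. ceval (q i) s)) j)" if "s \<notin> T" for s
  proof (rule gen)
    show "s \<notin> T0" using that by (simp add: T_def)
    fix z assume "ceval (q k) z = ceval (q k) s"
    moreover have "ceval (q k) s \<notin> V" using that by (simp add: T_def)
    ultimately show "ceval (pderiv (q k)) z \<noteq> 0" by (metis (mono_tags, lifting) V_def image_eqI mem_Collect_eq)
  qed simp
  obtain s0 :: complex where "s0 \<notin> T" using T ex_new_if_finite infinite_UNIV_char_0 by blast
  then have r: "r \<noteq> 0" using *[of s0] by auto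
  obtain C where C: "C \<ge> 1" "\<And>z s. ceval (q k) z = ceval (q k) s \<Longrightarrow> norm z \<le> C * (1 + norm s)"
    using ceval_eq_imp_norm_le[OF k] by blast
  have "\<exists>c. n j = r * c \<and> degree c \<le> e" for j
  proof -
    have "norm (ceval (n j) s) \<le> (1 + C) ^ e * norm (ceval r s) * (1 + norm s) ^ e" if s: "s \<notin> T" for s
    proof -
      have "norm (coeff (fibre_poly q (\<lambda>i. ceval (q i) s)) j) \<le> (1 + C * (1 + norm s)) ^ e"
      proof -
        have "norm z \<le> C * (1 + norm s)" if "z \<in> fibre q (\<lambda>i. ceval (q i) s)" for z
          using that by (intro C(2)) (simp add: fibre_def)
        then show ?thesis
          using norm_coeff_prod_linear_le[OF finite_fibre[of q k "\<lambda>i. ceval (q i) s", OF k], of "C * (1 + norm s)" j] C(1) *[OF s]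
          by (simp add: fibre_poly_def)
      qed
      also have "\<dots> \<le> ((1 + C) * (1 + norm s)) ^ e"
        using C(1) by (intro power_mono) (auto simp: algebra_simps)
      finally have "norm (coeff (fibre_poly q (\<lambda>i. ceval (q i) s)) j) \<le> (1 + C) ^ e * (1 + norm s) ^ e"
        by (simp add: power_mult_distrib)
      then show ?thesis
        using *[OF s] by (simp add: norm_mult mult.left_commute mult.assoc mult_left_mono)
    qed
    then show ?thesis using quotient_polynomial_if_growth_le[OF r T] by metis
  qed
  then obtain c where c: "\<And>j. n j = r * c j \<and> degree (c j) \<le> e" by metis
  show thesis
  proof (rule that[of T c e])
    fix s assume "s \<notin> T"
    from *[OF this] show "card (fibre q (\<lambda>i. ceval (q i) s)) = e \<and>
       (\<forall>j. coeff (fibre_poly q (\<lambda>i. ceval (q i) s)) j = ceval (c j) s)"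
      using c by auto
  qed (use T c in auto)
qed

lemma card_ceval_eq_le: "degree p \<noteq> 0 \<Longrightarrow> card {z. ceval p z = c} \<le> degree p"
proof -
  assume p: "degree p \<noteq> 0"
  let ?P = "map_poly of_real p - [:c:]"
  have deg: "degree ?P = degree p"
    using p degree_diff_le_max
    by (metis (no_types, lifting) degree_add_eq_left degree_map_poly_of_real degree_minus degree_pCons_0 diff_conv_add_uminus not_gr_zero)
  then have "?P \<noteq> 0" using p by (metis degree_0)
  then have "card {z. poly ?P z = 0} \<le> degree ?P" by (rule card_poly_roots_bound)
  then show ?thesis using deg by (simp add: ceval_def)
qed

text \<open>If all coefficients were constant, almost all parameters would lie in a single finite
  fibre. A nonconstant coefficient takes one value on the \<open>e\<close> points of a generic
  fibre, so its degree is at least \<open>e\<close>; growth gave the opposite inequality.\<close>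

lemma fibre_generator:
  fixes q :: "'m::finite \<Rightarrow> real poly"
  assumes k: "degree (q k) \<noteq> 0"
  obtains \<theta> j T where "finite T" "degree \<theta> \<noteq> 0"
    "\<And>s. s \<notin> T \<Longrightarrow> card (fibre q (\<lambda>i. ceval (q i) s)) = degree \<theta> \<and>
       coeff (fibre_poly q (\<lambda>i. ceval (q i) s)) j = ceval \<theta> s \<and>
       (\<forall>z\<in>fibre q (\<lambda>i. ceval (q i) s). ceval \<theta> z = ceval \<theta> s)"
proof -
  define F where "F s = fibre q (\<lambda>i. ceval (q i) s)" for s
  define P where "P s = fibre_poly q (\<lambda>i. ceval (q i) s)" for s
  have F_cong: "F z = F s" "P z = P s" if "z \<in> F s" for z s
    using that by (simp_all add: F_def P_def fibre_def)
  have finF: "finite (F s)" for s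
    unfolding F_def by (rule finite_fibre[of q k, OF k])
  obtain e c T0 where T0: "finite T0" and c_deg: "\<And>j. degree (c j) \<le> e"
    and c0: "\<And>s. s \<notin> T0 \<Longrightarrow> card (F s) = e \<and> (\<forall>j. coeff (P s) j = ceval (c j) s)"
    unfolding F_def P_def using fibre_poly_polynomial[of q k, OF k] by metis
  \<comment> \<open>Enlarged so that for \<open>s\<close> outside \<open>T\<close> the whole fibre
    through \<open>s\<close> avoids \<open>T0\<close>; the coefficient formula then holds at every
    point of that fibre.\<close>
  define T where "T = T0 \<union> {s. ceval (q k) s \<in> ceval (q k) ` T0}"
  have T: "finite T" using T0 k by (simp add: T_def finite_ceval_vimage)
  have c: "card (F s) = e" "coeff (P s) j = ceval (c j) s" if "s \<notin> T" for s j
    using c0[of s] that by (auto simp: T_def)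
  have inv: "ceval (c j) z = ceval (c j) s" if s: "s \<notin> T" and z: "z \<in> F s" for s z j
  proof -
    have "ceval (q k) z = ceval (q k) s" using z by (simp add: F_def fibre_def)
    then have "z \<notin> T0" using s by (metis T_def UnI2 image_eqI mem_Collect_eq)
    then show ?thesis using c0[of z] c(2)[OF s] F_cong[OF z] by metis
  qed
  have "\<exists>j. degree (c j) \<noteq> 0"
  proof (rule ccontr)
    assume "\<nexists>j. degree (c j) \<noteq> 0"
    then have "\<exists>d. c j = [:d:]" for j by (metis degree_eq_zeroE)
    then have const: "ceval (c j) s = ceval (c j) s'" for j s s' by (metis ceval_simps(5))
    obtain s0 where s0: "s0 \<notin> T" using T ex_new_if_finite infinite_UNIV_char_0 by blast
    have "P s = P s0" if "s \<notin> T" for s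
      using c(2)[OF that] c(2)[OF s0] const by (metis poly_eqI)
    moreover have "s \<in> F s" for s by (simp add: F_def fibre_def)
    ultimately have "- T \<subseteq> F s0"
      using finF unfolding F_def P_def by (metis ComplD poly_fibre_poly_eq_0_iff subsetI)
    then have "finite (- T)" using finF finite_subset by blast
    then show False using T by (metis finite_Un Compl_partition infinite_UNIV_char_0)
  qed
  then obtain j where j: "degree (c j) \<noteq> 0" by blast
  have "degree (c j) = e"
  proof (rule antisym[OF c_deg])
    obtain s0 where s0: "s0 \<notin> T" using T ex_new_if_finite infinite_UNIV_char_0 by blast
    have "card (F s0) \<le> card {z. ceval (c j) z = ceval (c j) s0}"
      using inv[OF s0] by (intro card_mono finite_ceval_eq[OF j]) auto
    also have "\<dots> \<le> degree (c j)" by (rule card_ceval_eq_le[OF j])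
    finally show "e \<le> degree (c j)" using c(1)[OF s0] by simp
  qed
  then show thesis
    using that[of T "c j" j] T j c inv unfolding F_def P_def by auto
qed

lemma constant_if_many_ceval_eq:
  assumes "finite A" "\<And>z. z \<in> A \<Longrightarrow> ceval p z = a" "degree p < card A"
  shows "degree p = 0"
proof (rule ccontr)
  assume p: "degree p \<noteq> 0"
  have "card A \<le> card {z. ceval p z = a}"
    using assms(2) by (intro card_mono finite_ceval_eq[OF p]) auto
  with card_ceval_eq_le[OF p, of a] assms(3) show False by simp
qed

text \<open>
  For a real \<open>s0\<close>, both \<open>b - b(s0)\<close> and \<open>\<theta> - \<theta>(s0)\<close> vanish on the fibre \<open>F s0\<close>, which has \<open>degree \<theta>\<close>
  elements, so the latter divides the former. The quotient is again constant on almost all fibres.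
\<close>

lemma factor_through_generator:
  fixes F :: "complex \<Rightarrow> complex set"
  assumes \<theta>: "degree \<theta> \<noteq> 0" and T: "finite T"
    and card: "\<And>s. s \<notin> T \<Longrightarrow> card (F s) = degree \<theta>"
    and inv: "\<And>s z. s \<notin> T \<Longrightarrow> z \<in> F s \<Longrightarrow> ceval \<theta> z = ceval \<theta> s"
    and b: "finite T'" "\<And>s z. s \<notin> T' \<Longrightarrow> z \<in> F s \<Longrightarrow> ceval b z = ceval b s"
  shows "\<exists>B. b = pcompose B \<theta>"
  using b
proof (induction "degree b" arbitrary: b T' rule: less_induct)
  case less
  show ?case
  proof (cases "degree b = 0")
    case True
    then obtain d where "b = [:d:]" by (rule degree_eq_zeroE)
    then show ?thesis by (intro exI[of _ "[:d:]"]) (simp add: pcompose_pCons)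
  next
    case False
    \<comment> \<open>A real base point keeps the subtracted constants, and with them
      \<open>\<eta>\<close> and the quotient, real.\<close>
    have "finite (complex_of_real -` (T \<union> T'))"
      using T less.prems(1) by (intro finite_vimageI) (auto intro: injI)
    then obtain s0 where s0: "of_real s0 \<notin> T \<union> T'"
      using ex_new_if_finite[OF infinite_UNIV_char_0] by (metis vimageI)
    let ?s = "complex_of_real s0"
    define \<eta> where "\<eta> = \<theta> - [:poly \<theta> s0:]"
    define b1 where "b1 = (b - [:poly b s0:]) div \<eta>"
    define c where "c = (b - [:poly b s0:]) mod \<eta>"
    have \<eta>: "degree \<eta> = degree \<theta>"
      unfolding \<eta>_def diff_conv_add_uminus using \<theta> by (intro degree_add_eq_left) simp
    have eq: "b - [:poly b s0:] = \<eta> * b1 + c" by (simp add: b1_def c_def)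
    have "ceval c z = 0" if "z \<in> F ?s" for z
      using arg_cong[OF eq, of "\<lambda>p. ceval p z"] inv[of ?s z] less.prems(2)[of ?s z] s0 that
      by (simp add: \<eta>_def)
    moreover have "card (F ?s) = degree \<theta>" using card s0 by simp
    moreover have "c = 0 \<or> degree c < degree \<eta>"
      unfolding c_def by (rule degree_mod_less) (use \<eta> \<theta> in auto)
    \<comment> \<open>The remainder has degree below \<open>degree \<theta>\<close> and vanishes at
      \<open>degree \<theta>\<close> points.\<close>
    ultimately have "c = 0"
    proof -
      assume c: "\<And>z. z \<in> F ?s \<Longrightarrow> ceval c z = 0" and cF: "card (F ?s) = degree \<theta>"
        and d: "c = 0 \<or> degree c < degree \<eta>"
      have fin: "finite (F ?s)" using cF \<theta> card_ge_0_finite[of "F ?s"] by simp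
      have "degree c = 0"
        by (rule constant_if_many_ceval_eq[OF fin c]) (use cF d \<eta> \<theta> in auto)
      then obtain a where a: "c = [:a:]" by (rule degree_eq_zeroE)
      obtain z where "z \<in> F ?s" using cF \<theta> by (metis card.empty equals0I)
      from c[OF this] show "c = 0" by (simp add: a)
    qed
    then have eq: "b = [:poly b s0:] + \<eta> * b1" using eq by (simp add: algebra_simps)
    have "degree b1 < degree b"
    proof (cases "b1 = 0")
      case False
      have "degree (\<eta> * b1) = degree \<theta> + degree b1"
        using False \<eta> \<theta> by (subst degree_mult_eq) auto
      moreover have "degree b \<ge> degree (\<eta> * b1)"
        using \<open>degree b \<noteq> 0\<close> eq by (metis add_diff_cancel_left' degree_diff_le degree_pCons_0 le0 order_refl)
      ultimately show ?thesis using \<theta> by simp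
    qed (use False in simp)
    \<comment> \<open>The zeros of \<open>\<eta>\<close> are excluded as well, since
      \<open>\<eta>\<close> must be cancelled to see that \<open>b1\<close> is constant on
      fibres.\<close>
    moreover have "finite (T \<union> T' \<union> {s. ceval \<theta> s = of_real (poly \<theta> s0)})"
      using T less.prems(1) \<theta> by (simp add: finite_ceval_eq)
    moreover have "ceval b1 z = ceval b1 s"
      if s: "s \<notin> T \<union> T' \<union> {s. ceval \<theta> s = of_real (poly \<theta> s0)}" and z: "z \<in> F s" for s z
    proof -
      have "ceval b x = of_real (poly b s0) + (ceval \<theta> x - of_real (poly \<theta> s0)) * ceval b1 x" for x
        using arg_cong[OF eq, of "\<lambda>p. ceval p x"] by (simp add: \<eta>_def)
      from this[of s] this[of z] show ?thesis
        using inv[of s z] less.prems(2)[of s z] s z by simp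
    qed
    ultimately obtain B1 where "b1 = pcompose B1 \<theta>" using less.hyps by metis
    then have "b = pcompose ([:poly b s0:] + [:- poly \<theta> s0, 1:] * B1) \<theta>"
      using eq by (simp add: \<eta>_def pcompose_pCons pcompose_mult pcompose_add pcompose_diff pcompose_smult pcompose_uminus algebra_simps)
    then show ?thesis by blast
  qed
qed

section \<open>Lifting a regular curve\<close>

text \<open>The binary form of \<open>Q\<close> at the pair \<open>(\<nu>, \<rho>)\<close>:
  \<open>Q(\<nu> / \<rho>)\<close> with denominators cleared, which still makes sense at zeros of
  \<open>\<rho>\<close>.\<close>

definition homogenization :: "real poly \<Rightarrow> real poly \<Rightarrow> real poly \<Rightarrow> real poly" where
  "homogenization Q \<nu> \<rho> = (\<Sum>l\<le>degree Q. smult (coeff Q l) (\<nu> ^ l * \<rho> ^ (degree Q - l)))"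

lemma poly_homogenization:
  assumes "poly \<rho> t \<noteq> 0"
  shows "poly (homogenization Q \<nu> \<rho>) t = poly \<rho> t ^ degree Q * poly Q (poly \<nu> t / poly \<rho> t)"
proof -
  have "poly \<rho> t ^ degree Q * poly Q (poly \<nu> t / poly \<rho> t) =
      (\<Sum>l\<le>degree Q. coeff Q l * (poly \<nu> t ^ l * (poly \<rho> t ^ degree Q / poly \<rho> t ^ l)))"
    by (simp add: poly_altdef[of Q] sum_distrib_left power_divide mult_ac)
  also have "\<dots> = (\<Sum>l\<le>degree Q. coeff Q l * (poly \<nu> t ^ l * poly \<rho> t ^ (degree Q - l)))"
    using assms by (intro sum.cong refl) (simp add: power_diff)
  finally show ?thesis by (simp add: homogenization_def poly_sum)
qed

lemma poly_homogenization_pole: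
  assumes "poly \<rho> t = 0"
  shows "poly (homogenization Q \<nu> \<rho>) t = lead_coeff Q * poly \<nu> t ^ degree Q"
proof -
  have "poly (homogenization Q \<nu> \<rho>) t =
      (\<Sum>l\<le>degree Q. if l = degree Q then lead_coeff Q * poly \<nu> t ^ degree Q else 0)"
    unfolding homogenization_def poly_sum using assms by (intro sum.cong) auto
  then show ?thesis by simp
qed

text \<open>One and the same coefficient of the fibre polynomial is \<open>\<theta>\<close> along
  \<open>q\<close> and a rational function along \<open>u / h\<close>. The curves share infinitely
  many generic points, where \<open>u / h = Q(\<nu> / \<rho>)\<close> follows from
  \<open>q = Q \<circ> \<theta>\<close>; a polynomial identity extends this to all
  parameters.\<close>

lemma lift_regular_curve:
  fixes q u h :: "'m::finite \<Rightarrow> real poly"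
  assumes k: "degree (q k) \<noteq> 0" and h: "\<And>i t. poly (h i) t \<noteq> 0"
    and sub: "\<And>s. \<exists>t. \<forall>i. poly (u i) t = poly (h i) t * poly (q i) s"
  obtains Q \<nu> \<rho> where "\<And>t. poly \<rho> t \<noteq> 0"
    "\<And>i t. poly (u i) t / poly (h i) t = poly (Q i) (poly \<nu> t / poly \<rho> t)"
proof -
  obtain \<theta> j T where generator: "finite T \<and> degree \<theta> \<noteq> 0 \<and> (\<forall>s. s \<notin> T \<longrightarrow>
      card (fibre q (\<lambda>i. ceval (q i) s)) = degree \<theta> \<and>
      coeff (fibre_poly q (\<lambda>i. ceval (q i) s)) j = ceval \<theta> s \<and>
      (\<forall>z\<in>fibre q (\<lambda>i. ceval (q i) s). ceval \<theta> z = ceval \<theta> s))"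
    by (rule fibre_generator[of q k, OF k], blast)
  then have T: "finite T" and \<theta>: "degree \<theta> \<noteq> 0" by blast+
  have card: "card (fibre q (\<lambda>i. ceval (q i) s)) = degree \<theta>" if "s \<notin> T" for s
    using generator that by blast
  have inv: "ceval \<theta> z = ceval \<theta> s" if "s \<notin> T" "z \<in> fibre q (\<lambda>i. ceval (q i) s)" for s z
    using generator that by blast
  have same: "ceval (q i) z = ceval (q i) s" if "z \<in> fibre q (\<lambda>i. ceval (q i) s)" for i s z
    using that by (simp add: fibre_def)
  have "\<exists>B. q i = pcompose B \<theta>" for i
    by (rule factor_through_generator[OF \<theta> T card inv finite.emptyI same])
  then obtain Q where Q: "\<And>i. q i = pcompose (Q i) \<theta>" by metis
  have Qk: "degree (Q k) \<noteq> 0" using k by (simp add: Q degree_pcompose)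
  have "h i \<noteq> 0" for i using h[of i 0] by auto
  then obtain e r n T2 where rational: "finite T2 \<and> (\<forall>t w. t \<notin> T2 \<longrightarrow>
       (\<forall>i. ceval (h i) t * w i = ceval (u i) t) \<longrightarrow>
       (\<forall>z. ceval (q k) z = w k \<longrightarrow> ceval (pderiv (q k)) z \<noteq> 0) \<longrightarrow>
       ceval r t \<noteq> 0 \<and> card (fibre q w) = e \<and> (\<forall>j. ceval (n j) t = ceval r t * coeff (fibre_poly q w) j))"
    by (rule fibre_poly_rational[of q k h u, OF k], blast)
  then have T2: "finite T2" by blast
  define V where "V = ceval (q k) ` {z. ceval (pderiv (q k)) z = 0}"
  have "pderiv (q k) \<noteq> 0" using k by (simp add: pderiv_eq_0_iff)
  then have V: "finite V" by (simp add: V_def finite_ceval_roots)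
  \<comment> \<open>The generic real parameters of \<open>q\<close>; \<open>R\<close> collects the
    parameters at which \<open>u / h\<close> passes through the corresponding points.\<close>
  define G where "G = {s::real. of_real s \<notin> T \<and> of_real (poly (q k) s) \<notin> V}"
  define R where "R = {t. \<exists>s\<in>G. \<forall>i. poly (u i) t = poly (h i) t * poly (q i) s}"
  have cofinite: "finite (- G)"
  proof -
    have "finite (complex_of_real -` (T \<union> {z. ceval (q k) z \<in> V}))"
      using T V k by (intro finite_vimageI) (auto intro: injI simp: finite_ceval_vimage)
    then show ?thesis by (rule rev_finite_subset) (auto simp: G_def)
  qed
  \<comment> \<open>On \<open>G\<close> the polynomial \<open>q k\<close> takes only values that
    \<open>u k / h k\<close> takes on \<open>R\<close>. Were \<open>R\<close> finite, then so would
    be \<open>G\<close>, because \<open>q k\<close> has finite fibres.\<close>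
  have R: "infinite R"
  proof
    assume "finite R"
    have "\<exists>t\<in>R. poly (q k) s = poly (u k) t / poly (h k) t" if "s \<in> G" for s
      using sub[of s] that h[of k] by (force simp: R_def)
    then have "G \<subseteq> complex_of_real -` {z. ceval (q k) z \<in> (\<lambda>t. of_real (poly (u k) t / poly (h k) t)) ` R}"
      by fastforce
    moreover have "finite (complex_of_real -` {z. ceval (q k) z \<in> (\<lambda>t. of_real (poly (u k) t / poly (h k) t)) ` R})"
      using \<open>finite R\<close> k by (intro finite_vimageI finite_ceval_vimage finite_imageI) (auto intro: injI)
    ultimately have "finite G" by (rule finite_subset)
    then show False using cofinite by (metis finite_Un Compl_partition infinite_UNIV_char_0)
  qed
  define R' where "R' = R - complex_of_real -` T2"
  have R': "infinite R'"
    unfolding R'_def using R T2 by (intro Diff_infinite_finite finite_vimageI) (auto intro: injI)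
  \<comment> \<open>The fibre over the common point is read off in two ways, from \<open>s\<close>
    along \<open>q\<close> and from \<open>t\<close> along \<open>u / h\<close>.\<close>
  have lift: "\<exists>s. poly r t \<noteq> 0 \<and> poly (n j) t = poly r t * poly \<theta> s \<and> (\<forall>i. poly (u i) t = poly (h i) t * poly (q i) s)"
    if t: "t \<in> R'" for t
  proof -
    obtain s where s: "s \<in> G" and us: "\<And>i. poly (u i) t = poly (h i) t * poly (q i) s"
      using t by (auto simp: R'_def R_def)
    have "ceval r (of_real t) \<noteq> 0 \<and> card (fibre q (\<lambda>i. ceval (q i) (of_real s))) = e \<and>
        (\<forall>j. ceval (n j) (of_real t) = ceval r (of_real t) * coeff (fibre_poly q (\<lambda>i. ceval (q i) (of_real s))) j)"
    proof (rule rational[THEN conjunct2, rule_format])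
      show "of_real t \<notin> T2" using t by (simp add: R'_def)
      show "ceval (h i) (of_real t) * ceval (q i) (of_real s) = ceval (u i) (of_real t)" for i
        by (simp add: us)
      fix z assume "ceval (q k) z = ceval (q k) (of_real s)"
      moreover have "ceval (q k) (of_real s) \<notin> V" using s by (simp add: G_def)
      ultimately show "ceval (pderiv (q k)) z \<noteq> 0"
        by (metis (mono_tags, lifting) V_def image_eqI mem_Collect_eq)
    qed
    then have nz: "ceval r (of_real t) \<noteq> 0" and n: "ceval (n j) (of_real t) =
        ceval r (of_real t) * coeff (fibre_poly q (\<lambda>i. ceval (q i) (of_real s))) j"
      by blast+
    have \<theta>s: "coeff (fibre_poly q (\<lambda>i. ceval (q i) (of_real s))) j = ceval \<theta> (of_real s)"
      using generator s unfolding G_def by blast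
    have "poly r t \<noteq> 0" using nz by simp
    moreover have "complex_of_real (poly (n j) t) = of_real (poly r t * poly \<theta> s)"
      using n unfolding \<theta>s by simp
    ultimately show ?thesis using us of_real_eq_iff by blast
  qed
  obtain t0 where "t0 \<in> R'" using R' by (metis finite.emptyI equals0I)
  then have "r \<noteq> 0" using lift by fastforce
  then obtain g \<nu> \<rho> where red: "n j = g * \<nu>" "r = g * \<rho>" "coprime \<nu> \<rho>" "g \<noteq> 0" "\<rho> \<noteq> 0"
    using reduced_fraction[of r "n j"] by metis
  have eq: "h i * homogenization (Q i) \<nu> \<rho> = \<rho> ^ degree (Q i) * u i" for i
  proof -
    let ?D = "h i * homogenization (Q i) \<nu> \<rho> - \<rho> ^ degree (Q i) * u i"
    have "poly ?D t = 0" if t: "t \<in> R'" for t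
    proof -
      obtain s where s: "poly r t \<noteq> 0" "poly (n j) t = poly r t * poly \<theta> s"
          "poly (u i) t = poly (h i) t * poly (q i) s"
        using lift[OF t] by blast
      then have "poly \<rho> t \<noteq> 0" "poly \<nu> t / poly \<rho> t = poly \<theta> s"
        by (auto simp: red field_simps)
      then show ?thesis using s(3) by (simp add: poly_homogenization Q poly_pcompose)
    qed
    then have "R' \<subseteq> {t. poly ?D t = 0}" by auto
    then have "infinite {t. poly ?D t = 0}" using R' finite_subset by blast
    then have "?D = 0" using poly_roots_finite by blast
    then show ?thesis by simp
  qed
  \<comment> \<open>At a zero of \<open>\<rho>\<close> only the leading term of the homogenization
    is left, so \<open>\<nu>\<close> would vanish too, against coprimality.\<close>
  have \<rho>: "poly \<rho> t \<noteq> 0" for t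
  proof
    assume t: "poly \<rho> t = 0"
    have "poly (h k * homogenization (Q k) \<nu> \<rho>) t = 0"
      unfolding eq using t Qk by simp
    then have "poly \<nu> t = 0"
      using h[of k t] Qk by (auto simp: poly_homogenization_pole[OF t])
    then show False
      using coprime_no_common_ceval_root[OF red(3), of "of_real t"] t by simp
  qed
  show thesis
  proof (rule that[of \<rho> Q \<nu>])
    show "poly (u i) t / poly (h i) t = poly (Q i) (poly \<nu> t / poly \<rho> t)" for i t
      using arg_cong[OF eq[of i], of "\<lambda>p. poly p t"] h[of i t] \<rho>[of t]
      by (simp add: poly_homogenization field_simps)
  qed (rule \<rho>)
qed

section \<open>Images of the real line\<close>

text \<open>Properness reduces the search for a minimum to a compact interval and, given the lower
  bound, makes \<open>f\<close> unbounded above; connectedness of the range fills in the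
  rest.\<close>

lemma range_proper_bdd_below:
  fixes f :: "real \<Rightarrow> real"
  assumes cont: "continuous_on UNIV f" and lim: "filterlim f at_infinity at_infinity"
    and bdd: "\<And>x. l \<le> f x"
  shows "\<exists>a. range f = {a..}"
proof -
  have proper: "\<exists>M\<ge>0. \<forall>x. M \<le> \<bar>x\<bar> \<longrightarrow> K \<le> \<bar>f x\<bar>" for K
  proof -
    have "eventually (\<lambda>x. K \<le> norm (f x)) at_infinity"
      using filterlim_at_infinity_imp_norm_at_top[OF lim] by (simp add: filterlim_at_top)
    then obtain b where "\<And>x. b \<le> norm x \<Longrightarrow> K \<le> norm (f x)"
      by (auto simp: eventually_at_infinity)
    then show ?thesis by (intro exI[of _ "max 0 b"]) auto
  qed
  \<comment> \<open>A value of absolute size above \<open>\<bar>l\<bar>\<close> cannot be negative,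
    and then it is at least \<open>f 0\<close>; so the minimum over \<open>{-M..M}\<close> is
    global.\<close>
  obtain M where M: "M \<ge> 0" "\<And>x. M \<le> \<bar>x\<bar> \<Longrightarrow> \<bar>f 0\<bar> + \<bar>l\<bar> + 1 \<le> \<bar>f x\<bar>" using proper by blast
  obtain x0 where x0: "x0 \<in> {-M..M}" "\<And>x. x \<in> {-M..M} \<Longrightarrow> f x0 \<le> f x"
    using continuous_attains_inf[of "{-M..M}" f] M(1) continuous_on_subset[OF cont] by auto
  have min: "f x0 \<le> f x" for x
  proof (cases "x \<in> {-M..M}")
    case False
    then have "\<bar>f 0\<bar> + \<bar>l\<bar> + 1 \<le> \<bar>f x\<bar>" by (intro M(2)) auto
    then have "f 0 \<le> f x" using bdd[of x] by linarith
    then show ?thesis using x0(2)[of 0] M(1) by auto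
  qed (rule x0)
  have "y \<in> range f" if y: "f x0 \<le> y" for y
  proof -
    obtain b where b: "\<bar>y\<bar> + \<bar>l\<bar> + 1 \<le> \<bar>f b\<bar>" using proper abs_ge_self by blast
    then have "y \<le> f b" using bdd[of b] by linarith
    moreover have "connected (range f)" by (rule connected_continuous_image[OF cont]) simp
    ultimately show ?thesis using connected_contains_Icc[of "range f" "f x0" "f b"] y by auto
  qed
  then have "range f = {f x0..}" using min by auto
  then show ?thesis ..
qed

text \<open>The range is a closed half-line, attained by \<open>a + x * x\<close> or its negative,
  or the whole line, attained by the identity.\<close>

lemma range_proper_eq_range_poly:
  fixes f :: "real \<Rightarrow> real"
  assumes cont: "continuous_on UNIV f" and lim: "filterlim f at_infinity at_infinity"
  obtains p :: "real poly" where "range f = range (poly p)"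
proof -
  have sqr: "range (\<lambda>x::real. a + x * x) = {a..}" for a
  proof (intro equalityI subsetI)
    fix y assume "y \<in> {a..}"
    then have "y = a + sqrt (y - a) * sqrt (y - a)" by simp
    then show "y \<in> range (\<lambda>x. a + x * x)" by blast
  qed auto
  consider l where "\<And>x. l \<le> f x" | l where "\<And>x. f x \<le> l"
    | "\<And>l. \<exists>x. f x < l" "\<And>l. \<exists>x. l < f x" by (meson not_le)
  then show thesis
  proof cases
    case 1
    then obtain a where "range f = {a..}" using range_proper_bdd_below[OF cont lim] by blast
    then show thesis using that[of "[:a, 0, 1:]"] sqr[of a] by simp
  next
    case (2 l)
    have "\<exists>a. range (\<lambda>x. - f x) = {a..}"
      using cont lim 2 by (intro range_proper_bdd_below[of _ "- l"] continuous_intros)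
        (auto simp: filterlim_at_infinity_conv_norm_at_top)
    then obtain a where "range (\<lambda>x. - f x) = range (\<lambda>x. a + x * x)" using sqr by metis
    then have "uminus ` range (\<lambda>x. - f x) = uminus ` range (\<lambda>x. a + x * x)" by simp
    then have "range f = range (\<lambda>x. - (a + x * x))" by (simp add: image_image)
    then show thesis using that[of "[:- a, 0, - 1:]"] by simp
  next
    case 3
    have "connected (range f)" by (rule connected_continuous_image[OF cont]) simp
    have "y \<in> range f" for y
    proof -
      obtain a b where "f a < y" "y < f b" using 3(1)[of y] 3(2)[of y] by blast
      then show ?thesis
        using connected_contains_Icc[OF \<open>connected (range f)\<close>, of "f a" "f b"] by auto
    qed
    then have "range f = UNIV" by blast
    moreover have "range (poly [:0, 1 :: real:]) = UNIV" by simp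
    ultimately show thesis using that by metis
  qed
qed

lemma rational_function_bounded:
  fixes \<nu> \<rho> :: "real poly"
  assumes \<rho>: "\<And>t. poly \<rho> t \<noteq> 0" and deg: "degree \<nu> \<le> degree \<rho>"
  shows "bounded (range (\<lambda>t. poly \<nu> t / poly \<rho> t))"
proof -
  let ?f = "\<lambda>t. poly \<nu> t / poly \<rho> t"
  have nz: "\<rho> \<noteq> 0" using \<rho>[of 0] by auto
  \<comment> \<open>The limit at infinity, which is 0 if \<open>\<nu>\<close> has smaller degree;
    subtracting \<open>smult c \<rho>\<close> removes the coefficient of degree
    \<open>degree \<rho>\<close>.\<close>
  define c where "c = coeff \<nu> (degree \<rho>) / lead_coeff \<rho>"
  have "degree (\<nu> - smult c \<rho>) \<le> degree \<rho>"
    using deg by (intro degree_diff_le) (auto intro: order_trans[OF degree_smult_le])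
  moreover have "coeff (\<nu> - smult c \<rho>) (degree \<rho>) = 0" using nz by (simp add: c_def)
  ultimately have "\<nu> - smult c \<rho> = 0 \<or> degree (\<nu> - smult c \<rho>) < degree \<rho>"
    by (rule eq_zero_or_degree_less)
  then have "((\<lambda>t. poly (\<nu> - smult c \<rho>) t / poly \<rho> t) \<longlongrightarrow> 0) at_infinity"
    using poly_divide_tendsto_0_at_infinity by fastforce
  then have "eventually (\<lambda>t. norm (poly (\<nu> - smult c \<rho>) t / poly \<rho> t) < 1) at_infinity"
    by (intro order_tendstoD(2)[OF tendsto_norm_zero]) simp_all
  then obtain M where M: "\<And>t. M \<le> \<bar>t\<bar> \<Longrightarrow> \<bar>poly (\<nu> - smult c \<rho>) t / poly \<rho> t\<bar> < 1"
    by (auto simp: eventually_at_infinity)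
  have far: "\<bar>?f t\<bar> \<le> \<bar>c\<bar> + 1" if "M \<le> \<bar>t\<bar>" for t
  proof -
    have "?f t = c + poly (\<nu> - smult c \<rho>) t / poly \<rho> t" using \<rho>[of t] by (simp add: field_simps)
    then show ?thesis using M[OF that] by linarith
  qed
  have "compact (?f ` {-M..M})"
    using \<rho> by (intro compact_continuous_image continuous_intros) auto
  then have "bounded (?f ` {-M..M} \<union> {-(\<bar>c\<bar> + 1)..\<bar>c\<bar> + 1})"
    by (simp add: compact_imp_bounded)
  moreover have "range ?f \<subseteq> ?f ` {-M..M} \<union> {-(\<bar>c\<bar> + 1)..\<bar>c\<bar> + 1}"
  proof
    fix y assume "y \<in> range ?f"
    then obtain t where "y = ?f t" by blast
    then show "y \<in> ?f ` {-M..M} \<union> {-(\<bar>c\<bar> + 1)..\<bar>c\<bar> + 1}"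
    proof (cases "M \<le> \<bar>t\<bar>")
      case True
      then have "\<bar>y\<bar> \<le> \<bar>c\<bar> + 1" using far \<open>y = ?f t\<close> by blast
      then have "y \<in> {-(\<bar>c\<bar> + 1)..\<bar>c\<bar> + 1}" unfolding atLeastAtMost_iff by linarith
      then show ?thesis ..
    next
      case False
      then have "t \<in> {-M..M}" by auto
      then show ?thesis using \<open>y = ?f t\<close> by blast
    qed
  qed
  ultimately show ?thesis by (rule bounded_subset)
qed

lemma rational_function_at_infinity:
  fixes \<nu> \<rho> :: "real poly"
  assumes \<rho>: "\<And>t. poly \<rho> t \<noteq> 0" and deg: "degree \<rho> < degree \<nu>"
  shows "filterlim (\<lambda>t. poly \<nu> t / poly \<rho> t) at_infinity at_infinity"
proof -
  have "eventually (\<lambda>t. poly \<nu> t \<noteq> 0) at_infinity"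
    using deg by (intro filterlim_at_infinity_imp_eventually_ne filterlim_poly_at_infinity) simp
  then have "filterlim (\<lambda>t. poly \<rho> t / poly \<nu> t) (at 0) at_infinity"
    unfolding filterlim_at using poly_divide_tendsto_0_at_infinity[OF deg] \<rho>
    by (auto elim: eventually_mono)
  then have "filterlim (\<lambda>t. inverse (poly \<rho> t / poly \<nu> t)) at_infinity at_infinity"
    by (rule filterlim_compose[OF filterlim_inverse_at_infinity])
  then show ?thesis by simp
qed

lemma unbounded_range_poly:
  fixes p :: "real poly"
  assumes "degree p \<noteq> 0"
  shows "\<not> bounded (range (poly p))"
proof
  assume "bounded (range (poly p))"
  then obtain B where B: "\<And>x. norm (poly p x) \<le> B" by (auto simp: bounded_iff)
  have "eventually (\<lambda>x. B + 1 \<le> norm (poly p x)) at_infinity"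
    using filterlim_at_infinity_imp_norm_at_top[OF filterlim_poly_at_infinity[of p]] assms
    by (simp add: filterlim_at_top)
  then obtain b where "\<And>x. b \<le> norm x \<Longrightarrow> B + 1 \<le> norm (poly p x)"
    by (auto simp: eventually_at_infinity)
  from this[of "\<bar>b\<bar>"] B[of "\<bar>b\<bar>"] abs_ge_self[of b] show False by simp
qed

text \<open>Through \<open>g = Q \<circ> \<psi>\<close> the unbounded values of \<open>q k\<close>
  force \<open>\<psi>\<close> to be unbounded, hence \<open>degree \<rho> < degree \<nu>\<close> and
  \<open>\<psi>\<close> is proper. Only its range matters for that of \<open>g\<close>, so
  \<open>\<psi>\<close> can be replaced by a polynomial with the same range.\<close>

lemma regular_curve_polynomial:
  fixes g :: "real \<Rightarrow> real ^ 'm"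
  assumes h: "\<And>i t. poly (h i) t \<noteq> 0" and g: "\<And>i t. g t $ i = poly (u i) t / poly (h i) t"
    and k: "degree (q k) \<noteq> 0" and sub: "\<And>s. (\<chi> i. poly (q i) s) \<in> range g"
  obtains P where "range g = range (\<lambda>x. \<chi> i. poly (P i) x)"
proof -
  have "\<exists>t. \<forall>i. poly (u i) t = poly (h i) t * poly (q i) s" for s
  proof -
    obtain t where "(\<chi> i. poly (q i) s) = g t" using sub[of s] by blast
    then have "poly (q i) s = poly (u i) t / poly (h i) t" for i
      using g[of t i] by (metis vec_lambda_beta)
    then show ?thesis using h by (intro exI[of _ t]) auto
  qed
  then obtain Q \<nu> \<rho> where \<rho>: "\<And>t. poly \<rho> t \<noteq> 0"
    and eq: "\<And>i t. poly (u i) t / poly (h i) t = poly (Q i) (poly \<nu> t / poly \<rho> t)"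
    using lift_regular_curve[of q k h u, OF k h] by metis
  define \<psi> where "\<psi> t = poly \<nu> t / poly \<rho> t" for t
  have gQ: "g t = (\<chi> i. poly (Q i) (\<psi> t))" for t
    by (simp add: vec_eq_iff g eq \<psi>_def)
  have "\<not> bounded (range \<psi>)"
  proof
    assume "bounded (range \<psi>)"
    \<comment> \<open>The closure makes the set compact, so that continuity of \<open>Q k\<close>
      suffices.\<close>
    then have "bounded (poly (Q k) ` closure (range \<psi>))"
      by (intro compact_imp_bounded compact_continuous_image continuous_intros) (simp add: compact_closure)
    moreover have "range (poly (q k)) \<subseteq> poly (Q k) ` closure (range \<psi>)"
    proof
      fix y assume "y \<in> range (poly (q k))"
      then obtain s where "y = poly (q k) s" by blast
      moreover obtain t where "(\<chi> i. poly (q i) s) = g t" using sub[of s] by blast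
      ultimately have "y = poly (Q k) (\<psi> t)" unfolding gQ by (metis vec_lambda_beta)
      moreover have "\<psi> t \<in> closure (range \<psi>)"
        using closure_subset[of "range \<psi>"] by blast
      ultimately show "y \<in> poly (Q k) ` closure (range \<psi>)" by (metis imageI)
    qed
    ultimately show False using unbounded_range_poly[OF k] bounded_subset by blast
  qed
  then have "degree \<rho> < degree \<nu>"
    using rational_function_bounded[OF \<rho>, of \<nu>] unfolding \<psi>_def by fastforce
  then have "filterlim \<psi> at_infinity at_infinity"
    unfolding \<psi>_def using \<rho> by (intro rational_function_at_infinity)
  moreover have "continuous_on UNIV \<psi>"
    unfolding \<psi>_def using \<rho> by (intro continuous_intros) auto
  ultimately obtain p where p: "range \<psi> = range (poly p)"
    using range_proper_eq_range_poly by metis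
  have "range g = (\<lambda>y. \<chi> i. poly (Q i) y) ` range \<psi>" by (simp add: gQ image_image)
  also have "\<dots> = range (\<lambda>x. \<chi> i. poly (pcompose (Q i) p) x)"
    by (simp add: p image_image poly_pcompose)
  finally show thesis by (rule that)
qed

section \<open>Polynomial and regular images\<close>

lemma rpoly_eval_poly_substitution: "\<exists>P. \<forall>s. rpoly_eval p (\<lambda>i. poly (x i) s) = poly P s"
  by (intro exI[of _ "\<Sum>\<alpha>\<in>Poly_Mapping.keys p. [:Poly_Mapping.lookup p \<alpha>:] *
        (\<Prod>i\<in>Poly_Mapping.keys \<alpha>. x i ^ Poly_Mapping.lookup \<alpha> i)"])
    (simp add: rpoly_eval_def poly_sum poly_prod)

lemma univariate_rpoly:
  obtains p where "p \<in> rpolys_in 1" "\<And>x. rpoly_eval p x = poly P (x 0)"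
proof -
  define m where "m j = Poly_Mapping.single (0::nat) (j::nat)" for j
  define p where "p = (\<Sum>j\<le>degree P. Poly_Mapping.single (m j) (coeff P j))"
  have inj: "inj m" by (rule injI) (metis lookup_single_eq m_def)
  then have m_eq: "m i = m j \<longleftrightarrow> i = j" for i j by (simp add: inj_eq)
  have lookup: "Poly_Mapping.lookup p (m j) = coeff P j" if "j \<le> degree P" for j
    using that by (simp add: p_def lookup_sum lookup_single when_def m_eq)
  have keys: "Poly_Mapping.keys p \<subseteq> m ` {..degree P}"
    unfolding p_def by (rule order_trans[OF keys_sum]) auto
  have monomial: "(\<Prod>i\<in>Poly_Mapping.keys (m j). x i ^ Poly_Mapping.lookup (m j) i) = x 0 ^ j"
    for x :: "nat \<Rightarrow> real" and j
    by (simp add: m_def)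
  have "rpoly_eval p x = poly P (x 0)" for x
  proof -
    have "rpoly_eval p x = (\<Sum>\<alpha>\<in>m ` {..degree P}. Poly_Mapping.lookup p \<alpha> *
        (\<Prod>i\<in>Poly_Mapping.keys \<alpha>. x i ^ Poly_Mapping.lookup \<alpha> i))"
      unfolding rpoly_eval_def
      by (intro sum.mono_neutral_left keys) (auto simp: in_keys_iff)
    also have "\<dots> = (\<Sum>j\<le>degree P. coeff P j * x 0 ^ j)"
      by (simp add: sum.reindex[OF inj_on_subset[OF inj subset_UNIV]] lookup monomial)
    finally show ?thesis by (simp add: poly_altdef)
  qed
  moreover have "p \<in> rpolys_in 1"
    using keys by (fastforce simp: rpolys_in_def m_def split: if_splits)
  ultimately show thesis using that by blast
qed

definition line_point :: "real \<Rightarrow> nat \<Rightarrow> real" where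
  "line_point t i = (if i = 0 then t else 0)"

lemma topspace_Euclidean_space_1: "topspace (Euclidean_space 1) = range line_point"
proof -
  have "x = line_point (x 0)" if "\<forall>i\<ge>1. x i = 0" for x
    using that by (auto simp: line_point_def fun_eq_iff)
  then show ?thesis by (auto simp: topspace_Euclidean_space line_point_def)
qed

lemma polynomial_image_1_range:
  fixes P :: "'m::finite \<Rightarrow> real poly"
  shows "polynomial_image 1 (range (\<lambda>x. (\<chi> i. poly (P i) x) :: real ^ 'm))"
proof -
  define f where "f x = (\<chi> i. poly (P i) (x 0))" for x :: "nat \<Rightarrow> real"
  have "polynomial_map 1 f"
    unfolding polynomial_map_def f_def by (metis univariate_rpoly vec_lambda_beta)
  moreover have "range (\<lambda>x. \<chi> i. poly (P i) x) = f ` topspace (Euclidean_space 1)"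
    by (simp add: topspace_Euclidean_space_1 image_image f_def line_point_def del: One_nat_def)
  ultimately show ?thesis unfolding polynomial_image_def by blast
qed

lemma regular_image_1_range:
  fixes S :: "(real ^ 'm) set"
  assumes "regular_image 1 S"
  obtains g :: "real \<Rightarrow> real ^ 'm" and u h where "S = range g" "\<And>i t. poly (h i) t \<noteq> 0"
    "\<And>i t. g t $ i = poly (u i) t / poly (h i) t"
proof -
  obtain f where f: "regular_map 1 f" "S = f ` topspace (Euclidean_space 1)"
    using assms by (auto simp: regular_image_def)
  have "\<exists>U H. \<forall>t. poly H t \<noteq> 0 \<and> f (line_point t) $ i = poly U t / poly H t" for i
  proof -
    obtain a b where ab: "\<And>x. x \<in> topspace (Euclidean_space 1) \<Longrightarrow>
        rpoly_eval b x \<noteq> 0 \<and> f x $ i = rpoly_eval a x / rpoly_eval b x"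
      using f(1) unfolding regular_map_def by blast
    have "line_point t = (\<lambda>i. poly (if i = 0 then [:0, 1:] else 0) t)" for t
      by (auto simp: line_point_def fun_eq_iff)
    then obtain U H where "\<And>t. rpoly_eval a (line_point t) = poly U t"
        "\<And>t. rpoly_eval b (line_point t) = poly H t"
      using rpoly_eval_poly_substitution[of _ "\<lambda>i. if i = 0 then [:0, 1:] else 0"] by metis
    then show ?thesis using ab by (metis rangeI topspace_Euclidean_space_1)
  qed
  then obtain u h where "\<And>i t. poly (h i) t \<noteq> 0 \<and> f (line_point t) $ i = poly (u i) t / poly (h i) t"
    by metis
  then show thesis
    using that[of "\<lambda>t. f (line_point t)" h u] f(2) by (simp add: topspace_Euclidean_space_1 image_image del: One_nat_def)
qed

text \<open>The map is restricted to the line through preimages of \<open>a\<close> and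
  \<open>b\<close>; a coordinate in which these points differ takes distinct values at 0 and
  1.\<close>

lemma polynomial_image_contains_curve:
  fixes S :: "(real ^ 'm) set"
  assumes "polynomial_image n S" and ne: "a \<in> S" "b \<in> S" "a \<noteq> b"
  obtains q k where "degree (q k) \<noteq> 0" "\<And>s. (\<chi> i. poly (q i) s) \<in> S"
proof -
  obtain f where f: "polynomial_map n f" "S = f ` topspace (Euclidean_space n)"
    using assms by (auto simp: polynomial_image_def)
  obtain x y where xy: "x \<in> topspace (Euclidean_space n)" "y \<in> topspace (Euclidean_space n)" "a = f x" "b = f y"
    using ne f(2) by blast
  define l where "l i = [:x i, y i - x i:]" for i
  define z where "z s i = poly (l i) s" for s i
  have z: "z s \<in> topspace (Euclidean_space n)" for s
    using xy by (simp add: topspace_Euclidean_space z_def l_def)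
  have z01: "z 0 = x" "z 1 = y" by (auto simp: z_def l_def fun_eq_iff)
  have "\<exists>P. \<forall>s. f (z s) $ i = poly P s" for i
  proof -
    obtain p where "\<And>x. x \<in> topspace (Euclidean_space n) \<Longrightarrow> f x $ i = rpoly_eval p x"
      using f(1) unfolding polynomial_map_def by blast
    then show ?thesis
      using rpoly_eval_poly_substitution[of p l] z unfolding z_def by auto
  qed
  then obtain q where q: "\<And>i s. f (z s) $ i = poly (q i) s" by metis
  then have fz: "(\<chi> i. poly (q i) s) = f (z s)" for s by (simp add: vec_eq_iff)
  obtain k where "f x $ k \<noteq> f y $ k" using ne(3) xy by (auto simp: vec_eq_iff)
  then have "poly (q k) 0 \<noteq> poly (q k) 1" using q[of 0 k] q[of 1 k] z01 by simp
  then have "degree (q k) \<noteq> 0" by (metis degree_eq_zeroE poly_const_conv)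
  then show thesis using that fz z f(2) by simp
qed

text \<open>A finite infimum comes from a nonempty set, and \<open>enat\<close> is well-ordered, so
  the infimum is attained.\<close>

lemma Inf_enat_eqD:
  assumes "Inf {enat k |k. P k} = enat n"
  shows "P n" "m < n \<Longrightarrow> \<not> P m"
proof -
  have "{enat k |k. P k} \<noteq> {}"
    using assms by (metis Inf_empty enat.distinct(1) top_enat_def)
  then have "Inf {enat k |k. P k} \<in> {enat k |k. P k}"
    by (meson equals0I wellorder_InfI)
  then show "P n" using assms by auto
  show "\<not> P m" if "m < n"
  proof
    assume "P m"
    then have "Inf {enat k |k. P k} \<le> enat m" by (intro Inf_lower) auto
    then show False using assms that by simp
  qed
qed

theorem corollary1p5:
  shows "\<not> (\<exists>S :: (real ^ 'm) set.
           semialgebraic S \<and> semialgebraic_dim S = 1 \<and> p_invariant S = 2 \<and> r_invariant S = 1)"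
proof
  assume "\<exists>S :: (real ^ 'm) set.
           semialgebraic S \<and> semialgebraic_dim S = 1 \<and> p_invariant S = 2 \<and> r_invariant S = 1"
  then obtain S :: "(real ^ 'm) set" where "p_invariant S = enat 2" "r_invariant S = enat 1"
    by (auto simp: numeral_eq_enat one_enat_def)
  then have p2: "polynomial_image 2 S" and p1: "\<not> polynomial_image 1 S" and r1: "regular_image 1 S"
    unfolding p_invariant_def r_invariant_def
    using Inf_enat_eqD[of "\<lambda>k. k \<ge> 1 \<and> polynomial_image k S" 2]
      Inf_enat_eqD[of "\<lambda>k. k \<ge> 1 \<and> regular_image k S" 1] by auto
  obtain g :: "real \<Rightarrow> real ^ 'm" and u h where g: "S = range g" "\<And>i t. poly (h i) t \<noteq> 0"
      "\<And>i t. g t $ i = poly (u i) t / poly (h i) t"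
    using regular_image_1_range[OF r1] by metis
  show False
  proof (cases "\<exists>a\<in>S. \<exists>b\<in>S. a \<noteq> b")
    case True
    then obtain q k where "degree (q k) \<noteq> 0" "\<And>s. (\<chi> i. poly (q i) s) \<in> S"
      using polynomial_image_contains_curve[OF p2] by metis
    then obtain P where "S = range (\<lambda>x. \<chi> i. poly (P i) x)"
      using regular_curve_polynomial[OF g(2,3)] g(1) by metis
    then show False using p1 polynomial_image_1_range by metis
  next
    case False
    \<comment> \<open>As the range of \<open>g\<close>, \<open>S\<close> is nonempty, so it is a
      single point and the image of a constant map.\<close>
    then have "S = range (\<lambda>x::real. \<chi> i. poly [:g 0 $ i:] x)"
      using g(1) by (auto simp: vec_eq_iff)
    then show False using p1 polynomial_image_1_range by metis
  qed
qed

end
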